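(* Let $P$ be a stochastic matrix over the finite set $X = X^o \cup \partial X$ satisfying properties (i), (ii), (iii) listed in the context, let $\lambda\in\mathrm{res}(P_{X^o})$, and let $n\ge 1$ be an integer. A function $f:X\to\mathbb{C}$ satisfies $\Delta_\lambda^n f=0$ on all of $X$ if and only if $f$ is $\lambda$-harmonic.
   Context: $X$ is a finite set, the disjoint union of two non-empty subsets $X^o$ (the interior) and $\partial X$ (the boundary). $P = (p(x,y))_{x,y\in X}$ is a stochastic matrix (non-negative entries, row sums $1$), and $p^{(n)}(x,y)$ denotes the $(x,y)$-entry of $P^n$. The standing assumptions are: (i) for every $x\in X^o$ there is $w\in\partial X$ with $p^{(n)}(x,w)>0$ for some $n$; (ii) for every $w\in\partial X$, $p(w,w)=1$, and thus $p(w,x)=0$ for all $x\in X\setminus\{w\}$; (iii) for every $w\in\partial X$ there is $x\in X^o$ with $p^{(n)}(x,w)>0$ for some $n$. $P$ acts on functions $f:X\to\mathbb{C}$ by $Pf(x)=\sum_{y\in X} p(x,y)f(y)$. $P_{X^o}$ and $Q$ are the restrictions of $P$ to $X^o\times X^o$ and $X^o\times\partial X$, respectively; $I_{X^o}$ is the identity matrix over $X^o$; $\mathrm{res}(P_{X^o})=\mathbb{C}\setminus\mathrm{spec}(P_{X^o})$ is the complement of the set of eigenvalues of $P_{X^o}$. The $\lambda$-Laplacian is the $X\times X$-matrix given in block form (with respect to $X=X^o\cup\partial X$) by $$\Delta_\lambda=\begin{pmatrix}\lambda\cdot I_{X^o}-P_{X^o} & -Q\\ 0&0\end{pmatrix}.$$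 A function $h:X\to\mathbb{C}$ is called $\lambda$-harmonic if $Ph(x)=\lambda\,h(x)$ for every $x\in X^o$. *)

theory Defs
  imports "HOL-Analysis.Analysis"
begin

text \<open>The set \<open>X\<close> is the sum type \<open>'i + 'b\<close>: the interior is the range of \<^const>\<open>Inl\<close> and the
  boundary is the range of \<^const>\<open>Inr\<close>. Both are finite, non-empty and disjoint because the types
  are finite and every type is inhabited. Functions \<open>X \<rightarrow> \<complex>\<close> are vectors indexed by \<open>'i + 'b\<close>.\<close>

definition stochastic :: "real^'x^'x \<Rightarrow> bool" where
  "stochastic P \<longleftrightarrow> (\<forall>x y. P $ x $ y \<ge> 0) \<and> (\<forall>x. (\<Sum>y\<in>UNIV. P $ x $ y) = 1)"

text \<open>A separate definition is needed because \<^term>\<open>(^)\<close> on the vector type is not the power with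
  respect to the matrix product.\<close>

primrec mat_power :: "'a::semiring_1^'x^'x \<Rightarrow> nat \<Rightarrow> 'a^'x^'x" where
  "mat_power A 0 = mat 1"
| "mat_power A (Suc n) = A ** mat_power A n"

definition spec :: "complex^'x^'x \<Rightarrow> complex set" where
  "spec A = {\<mu>. \<exists>v. v \<noteq> 0 \<and> A *v v = \<mu> *s v}"

definition res :: "complex^'x^'x \<Rightarrow> complex set" where
  "res A = UNIV - spec A"

definition P_int :: "real^('i::finite + 'b::finite)^('i + 'b) \<Rightarrow> complex^'i^'i" where
  "P_int P = (\<chi> x y. complex_of_real (P $ Inl x $ Inl y))"

definition Q_bd :: "real^('i::finite + 'b::finite)^('i + 'b) \<Rightarrow> complex^'b^'i" where
  "Q_bd P = (\<chi> x w. complex_of_real (P $ Inl x $ Inr w))"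

definition act :: "real^'x^'x \<Rightarrow> complex^'x \<Rightarrow> complex^'x" where
  "act P f = map_matrix complex_of_real P *v f"

definition block_mat ::
  "'a^'i^'i \<Rightarrow> 'a^'b^'i \<Rightarrow> 'a^'i^'b \<Rightarrow> 'a^'b^'b \<Rightarrow> 'a^('i::finite + 'b::finite)^('i + 'b)" where
  "block_mat A B C D = (\<chi> s t. case s of
       Inl x \<Rightarrow> (case t of Inl y \<Rightarrow> A $ x $ y | Inr w \<Rightarrow> B $ x $ w)
     | Inr v \<Rightarrow> (case t of Inl y \<Rightarrow> C $ v $ y | Inr w \<Rightarrow> D $ v $ w))"

text \<open>The scalar \<open>\<mu>\<close> is the parameter written \<open>\<lambda>\<close> in the literature; \<^term>\<open>mat \<mu>\<close> is \<open>\<mu>\<close> times the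
  identity matrix.\<close>

definition laplacian ::
  "complex \<Rightarrow> real^('i::finite + 'b::finite)^('i + 'b) \<Rightarrow> complex^('i + 'b)^('i + 'b)" where
  "laplacian \<mu> P = block_mat (mat \<mu> - P_int P) (- Q_bd P) 0 0"

definition harmonic ::
  "complex \<Rightarrow> real^('i::finite + 'b::finite)^('i + 'b) \<Rightarrow> complex^('i + 'b) \<Rightarrow> bool" where
  "harmonic \<mu> P h \<longleftrightarrow> (\<forall>x. act P h $ Inl x = \<mu> * h $ Inl x)"

end

theory Submission
  imports Defs
begin

text \<open>Every function in the image of \<open>\<Delta>\<^sub>\<lambda>\<close> vanishes on the boundary, and on such functions
  \<open>\<Delta>\<^sub>\<lambda>\<close> acts as \<open>\<lambda>I - P\<close> on the interior, which is injective because \<open>\<lambda>\<close> is in the resolvent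
  set. So the kernels of all powers \<open>\<Delta>\<^sub>\<lambda>\<^sup>n\<close>, \<open>n \<ge> 1\<close>, agree with that of \<open>\<Delta>\<^sub>\<lambda>\<close>.\<close>

lemma sum_UNIV_sum_type:
  fixes g :: "'i::finite + 'b::finite \<Rightarrow> 'c::comm_monoid_add"
  shows "sum g UNIV = (\<Sum>x\<in>UNIV. g (Inl x)) + (\<Sum>w\<in>UNIV. g (Inr w))"
  using sum.Plus[of UNIV UNIV g] by (simp add: UNIV_Plus_UNIV comp_def)

lemma act_Inl:
  "act P g $ Inl x = (P_int P *v (\<chi> y. g $ Inl y)) $ x + (Q_bd P *v (\<chi> w. g $ Inr w)) $ x"
  by (simp add: act_def P_int_def Q_bd_def matrix_vector_mult_def map_matrix_def sum_UNIV_sum_type)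

lemma laplacian_Inl: "(laplacian \<mu> P *v g) $ Inl x = \<mu> * g $ Inl x - act P g $ Inl x"
proof -
  have "(\<Sum>y\<in>UNIV. mat \<mu> $ x $ y * g $ Inl y) = \<mu> * g $ Inl x"
    by (simp add: mat_def if_distrib[where f = "\<lambda>a. a * _"] cong: if_cong)
  then show ?thesis
    by (simp add: act_Inl laplacian_def block_mat_def matrix_vector_mult_def sum_UNIV_sum_type
        left_diff_distrib sum_subtractf sum_negf)
qed

lemma laplacian_Inr: "(laplacian \<mu> P *v g) $ Inr w = 0"
  by (simp add: laplacian_def block_mat_def matrix_vector_mult_def sum_UNIV_sum_type)

text \<open>The zero boundary rows impose no condition, so only the interior equations
  remain.\<close>

lemma laplacian_eq_0_iff_harmonic: "laplacian \<mu> P *v g = 0 \<longleftrightarrow> harmonic \<mu> P g"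
  by (auto simp: vec_eq_iff split_sum_all harmonic_def laplacian_Inl laplacian_Inr)

text \<open>With zero boundary values the \<open>Q_bd\<close> term drops out, so a nonzero interior
  part of \<open>g\<close> would be an eigenvector of \<open>P_int P\<close> for \<mu>.\<close>

lemma harmonic_eq_0_if_boundary_0:
  assumes "\<mu> \<in> res (P_int P)" and harm: "harmonic \<mu> P g" and bd: "\<And>w. g $ Inr w = 0"
  shows "g = 0"
proof -
  let ?v = "\<chi> y. g $ Inl y"
  have "(Q_bd P *v (\<chi> w. g $ Inr w)) $ x = 0" for x
    by (simp add: matrix_vector_mult_def bd)
  then have "P_int P *v ?v = \<mu> *s ?v"
    using harm by (simp add: vec_eq_iff harmonic_def act_Inl)
  then have "?v = 0"
    using assms(1) unfolding res_def spec_def by blast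
  then show ?thesis
    by (simp add: vec_eq_iff split_sum_all bd)
qed

theorem mainTheorem7:
  fixes P :: "real^('i::finite + 'b::finite)^('i + 'b)"
    and \<mu> :: complex and n :: nat and f :: "complex^('i + 'b)"
  assumes "stochastic P"
    and "\<forall>x. \<exists>w k. mat_power P k $ Inl x $ Inr w > 0"
    and "\<forall>w. P $ Inr w $ Inr w = 1"
    and "\<forall>w. \<exists>x k. mat_power P k $ Inl x $ Inr w > 0"
    and "\<mu> \<in> res (P_int P)"
    and "n \<ge> 1"
  shows "mat_power (laplacian \<mu> P) n *v f = 0 \<longleftrightarrow> harmonic \<mu> P f"
  using \<open>n \<ge> 1\<close>
proof (induction n rule: dec_induct)
  case base
  then show ?case
    by (simp add: laplacian_eq_0_iff_harmonic)
next
  case (step m)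
  let ?g = "mat_power (laplacian \<mu> P) m *v f"
  \<comment> \<open>As m \<ge> 1, the power has an outermost factor
    \<open>laplacian \<mu> P\<close>, which makes \<open>?g\<close> vanish on the boundary; for m =
    0, \<open>?g\<close> would be \<open>f\<close> itself.\<close>
  obtain k where k: "m = Suc k"
    using \<open>1 \<le> m\<close> by (cases m) auto
  have "?g $ Inr w = 0" for w
    by (simp add: k laplacian_Inr flip: matrix_vector_mul_assoc)
  \<comment> \<open>If the left side holds, \<open>?g\<close> is harmonic with zero boundary values.
    The extra factor in the power \<open>Suc m\<close> thus leaves the kernel unchanged.\<close>
  then have "laplacian \<mu> P *v ?g = 0 \<longleftrightarrow> ?g = 0"
    using harmonic_eq_0_if_boundary_0[OF assms(5)]
    by (metis laplacian_eq_0_iff_harmonic matrix_vector_mult_0_right)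
  then show ?case
    using step.IH by (simp flip: matrix_vector_mul_assoc)
qed

end
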